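(* Let $G$ be a connected claw-free graph and let $I$ and $J$ be independent sets of $G$ with $|I|=|J|$. Then $I\leftrightarrow_{\mathrm{TS}} J$ if and only if every cycle in $G[I\Delta J]$ is resolvable with respect to $I$.
   Context: Graphs are finite and simple; claw-free means no induced $K_{1,3}$. $I\Delta J=(I\setminus J)\cup(J\setminus I)$. A TS-sequence is a sequence $I_0,\ldots,I_m$ of independent sets of the same size such that each $I_{i+1}$ is obtained from $I_i$ by a move $u\to v$: $uv\in E(G)$, $I_i\setminus I_{i+1}=\{u\}$, $I_{i+1}\setminus I_i=\{v\}$. $I\leftrightarrow_{\mathrm{TS}} J$ means a TS-sequence from $I$ to $J$ exists. For a set $I$, a cycle $v_0,v_1,\ldots,v_k=v_0$ is $I$-bad if $|\{v_i,v_{i+1}\}\cap I|=1$ for all $i$ and $G[\{v_0,\ldots,v_{k-1}\}]$ is a cycle (the cycle is chordless). (Every cycle of $G[I\Delta J]$ is $I$-bad.) The $I$-bipartition of an $I$-bad cycle $C$ is $[A,B]$ with $A=V(C)\cap I$, $B=V(C)\setminus I$. An $I$-bad cycle $C$ with $I$-bipartition $[A,B]$ is resolvable with respect to $I$ if there is an independent set $I'$ with $I\leftrightarrow_{\mathrm{TS}} I'$ such that $G[I'\cup B]$ contains no cycle. *)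

theory Defs
  imports "Graph_Theory.Graph_Theory"
begin

text \<open>
  Finite simple graphs are the symmetric, loop-free digraphs without parallel arcs of the locale
  \<open>graph\<close>; an edge $uv$ is the pair of arcs \<open>u \<rightarrow>\<^bsub>G\<^esub> v\<close>, \<open>v \<rightarrow>\<^bsub>G\<^esub> u\<close>.
\<close>

definition claw_free :: "('a,'b) pre_digraph \<Rightarrow> bool" where
  "claw_free G \<longleftrightarrow> \<not> (\<exists>H. induced_subgraph H G \<and> K\<^bsub>1,3\<^esub> H)"

definition independent_set :: "('a,'b) pre_digraph \<Rightarrow> 'a set \<Rightarrow> bool" where
  "independent_set G I \<longleftrightarrow> I \<subseteq> verts G \<and> (\<forall>u\<in>I. \<forall>v\<in>I. \<not> u \<rightarrow>\<^bsub>G\<^esub> v)"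

definition ts_move :: "('a,'b) pre_digraph \<Rightarrow> 'a set \<Rightarrow> 'a set \<Rightarrow> bool" where
  "ts_move G I I' \<longleftrightarrow> (\<exists>u v. u \<rightarrow>\<^bsub>G\<^esub> v \<and> I - I' = {u} \<and> I' - I = {v})"

definition ts_sequence :: "('a,'b) pre_digraph \<Rightarrow> 'a set list \<Rightarrow> bool" where
  "ts_sequence G Is \<longleftrightarrow> Is \<noteq> [] \<and> (\<forall>I\<in>set Is. independent_set G I)
     \<and> (\<forall>I\<in>set Is. \<forall>J\<in>set Is. card I = card J) \<and> successively (ts_move G) Is"

definition ts_reachable :: "('a,'b) pre_digraph \<Rightarrow> 'a set \<Rightarrow> 'a set \<Rightarrow> bool" where
  "ts_reachable G I J \<longleftrightarrow> (\<exists>Is. ts_sequence G Is \<and> hd Is = I \<and> last Is = J)"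

text \<open>
  A cycle is given by its vertex list $[v_0, v_1, \ldots, v_k]$ with $v_k = v_0$. The library's
  \<open>pre_digraph.cycle\<close> is unsuitable: in a symmetric digraph it also holds for the closed walk
  $u, v, u$ along a single edge. The length bound, that is $k \ge 3$, excludes this.
\<close>

definition graph_cycle :: "('a,'b) pre_digraph \<Rightarrow> 'a vwalk \<Rightarrow> bool" where
  "graph_cycle G C \<longleftrightarrow> vwalk C G \<and> hd C = last C \<and> distinct (tl C) \<and> 3 \<le> vwalk_length C"

text \<open>
  The last conjunct says that the subgraph induced by the vertices of \<open>C\<close> is the cycle \<open>C\<close> itself.
\<close>

definition bad_cycle :: "('a,'b) pre_digraph \<Rightarrow> 'a set \<Rightarrow> 'a vwalk \<Rightarrow> bool" where
  "bad_cycle G I C \<longleftrightarrow> graph_cycle G C \<and> (\<forall>(u,v)\<in>set (vwalk_arcs C). card ({u,v} \<inter> I) = 1)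
     \<and> arcs_ends (G \<restriction> set C) = set (vwalk_arcs C) \<union> (set (vwalk_arcs C))\<inverse>"

text \<open>
  The part $B = V(C) \setminus I$ of the $I$-bipartition is \<open>set C - I\<close>.
\<close>

definition resolvable :: "('a,'b) pre_digraph \<Rightarrow> 'a set \<Rightarrow> 'a vwalk \<Rightarrow> bool" where
  "resolvable G I C \<longleftrightarrow> bad_cycle G I C
     \<and> (\<exists>I'. independent_set G I' \<and> ts_reachable G I I'
           \<and> \<not> (\<exists>D. graph_cycle (G \<restriction> (I' \<union> (set C - I))) D))"

end

theory Submission
  imports Defs
begin

text \<open>
  If $I \leftrightarrow J$, the set $J$ itself resolves every cycle of $G[I \Delta J]$, because the
  part of the cycle outside $I$ lies in $J$. For the converse consider first the case without
  cycles. A vertex of $I \Delta J$ with exactly one neighbour in the other set gives a move that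
  shrinks $I \Delta J$. If there is none, claw-freeness makes all degrees in $G[I \Delta J]$ be $0$
  or $2$, hence all $0$, so $I \cup J$ is independent. A token then jumps from $x \in I \setminus J$
  to $y \in J \setminus I$ along a shortest path: a further token next to the path is, by
  claw-freeness, closer to both ends than these are to each other, and two shorter jumps suffice.

  Now let $C$ be a resolvable cycle with bipartition $[A,B]$, and follow the moves of a resolving
  sequence. As long as the tokens near $B$ form a cycle together with $B$, the tokens away from $B$
  move independently of it. The first move that breaks the cycle leaves a path, so the acyclic case
  carries the tokens near $B$ onto $B$, and undoing the moves away from $B$ ends in
  $(I \setminus A) \cup B$. This removes $C$ from $I \Delta J$ without affecting other cycles.
\<close>

unbundle no funcset_syntax

section \<open>Vertex walks and cycles\<close>

lemma vwalk_arcs_iff: "(u,v) \<in> set (vwalk_arcs p) \<longleftrightarrow> (\<exists>xs ys. p = xs @ u # v # ys)"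
proof (induct p rule: vwalk_arcs.induct)
  case (3 x y xs)
  show ?case
  proof
    assume "(u,v) \<in> set (vwalk_arcs (x # y # xs))"
    then show "\<exists>as bs. x # y # xs = as @ u # v # bs"
      using 3 by (auto intro: exI[of _ "[]"]) (metis append_Cons)
  next
    assume "\<exists>as bs. x # y # xs = as @ u # v # bs"
    then obtain as bs where "x # y # xs = as @ u # v # bs" by blast
    then show "(u,v) \<in> set (vwalk_arcs (x # y # xs))"
      using 3 by (cases as) auto
  qed
qed auto

lemma vwalk_arcsE:
  assumes "(u,v) \<in> set (vwalk_arcs p)"
  obtains xs ys where "p = xs @ u # v # ys"
  using assms vwalk_arcs_iff by metis

text \<open>Membership in \<open>T\<close> cannot change along an arc, so it is constant along the
  walk. This is how the connectedness of a cycle enters: it yields the last condition of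
  \<open>ring_around\<close>.\<close>

lemma vwalk_closed:
  assumes "\<And>x y. (x,y) \<in> set (vwalk_arcs p) \<Longrightarrow> x \<in> T \<longleftrightarrow> y \<in> T" "set p \<inter> T \<noteq> {}"
  shows "set p \<subseteq> T"
  using assms
proof (induct p rule: vwalk_arcs.induct)
  case (3 x y xs)
  have "x \<in> T \<longleftrightarrow> y \<in> T" using 3(2) by auto
  then have "set (y # xs) \<inter> T \<noteq> {}" using 3(3) by auto
  then have "set (y # xs) \<subseteq> T" using 3(1,2) by auto
  then show ?case using \<open>x \<in> T \<longleftrightarrow> y \<in> T\<close> by auto
qed auto

lemma graph_cycle_neighbours:
  assumes "graph_cycle H C" "v \<in> set C"
  obtains p s where "p \<noteq> s" "(p,v) \<in> set (vwalk_arcs C)" "(v,s) \<in> set (vwalk_arcs C)"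
proof -
  from assms(1) have C: "hd C = last C" "distinct (tl C)" "length C \<ge> 4"
    by (auto simp: graph_cycle_def)
  then obtain x t where Ct: "C = x # t" "t \<noteq> []" by (cases C; cases "tl C") auto
  have x: "x = last t" and t: "distinct t" "length t \<ge> 3" using C Ct by auto
  have "v \<in> set t" using assms(2) Ct x by auto
  then obtain xs ys where split: "t = xs @ v # ys" by (meson split_list)
  \<comment> \<open>The vertices of the cycle are the distinct entries of \<open>t\<close>, read
    cyclically. Since \<open>x = last t\<close>, the first entry has predecessor \<open>x\<close>
    and the last entry has successor \<open>hd t\<close>.\<close>
  define p where "p = (if xs = [] then x else last xs)"
  define s where "s = (if ys = [] then hd t else hd ys)"
  have "(p,v) \<in> set (vwalk_arcs C)"
  proof (cases xs rule: rev_cases)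
    case Nil
    then show ?thesis using split Ct by (simp add: p_def)
  next
    case (snoc zs z)
    then have "C = (x # zs) @ p # v # ys" using split Ct by (simp add: p_def)
    then show ?thesis unfolding vwalk_arcs_iff by blast
  qed
  moreover have "(v,s) \<in> set (vwalk_arcs C)"
  proof (cases ys)
    case Nil
    then have "C = [] @ v # s # tl t" using split Ct x by (auto simp: s_def)
    then show ?thesis unfolding vwalk_arcs_iff by blast
  next
    case (Cons z zs)
    then have "C = (x # xs) @ v # s # zs" using split Ct by (simp add: s_def)
    then show ?thesis unfolding vwalk_arcs_iff by blast
  qed
  \<comment> \<open>Here the length bound matters: with only two entries in \<open>t\<close>,
    predecessor and successor would coincide.\<close>
  moreover have "p \<noteq> s"
  proof (cases "xs = []")
    case True
    then obtain y z zs where "ys = y # z # zs" using split t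
      by (cases ys; cases "tl ys") auto
    then show ?thesis using True x split t by (auto simp: p_def s_def split: if_splits)
  next
    case xs: False
    show ?thesis
    proof (cases "ys = []")
      case True
      then obtain y z zs where "xs = y # z # zs" using split t
        by (cases xs; cases "tl xs") auto
      then show ?thesis using True split t by (auto simp: p_def s_def split: if_splits)
    next
      case False
      then show ?thesis using xs split t
        by (metis IntI UnCI append_is_Nil_conv distinct_append empty_iff hd_in_set last_in_set
            p_def s_def set_ConsD list.set_intros(2))
    qed
  qed
  ultimately show thesis using that by blast
qed

lemma arcs_ends_induce: "u \<rightarrow>\<^bsub>G \<restriction> S\<^esub> v \<longleftrightarrow> u \<rightarrow>\<^bsub>G\<^esub> v \<and> u \<in> S \<and> v \<in> S"
  by (auto simp: arcs_ends_conv)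

lemma graph_cycle_mono:
  assumes "graph_cycle (G \<restriction> S) C" "S \<subseteq> T"
  shows "graph_cycle (G \<restriction> T) C"
  using assms by (fastforce simp: graph_cycle_def vwalk_def arcs_ends_induce subset_iff)

lemma graph_cycle_induce:
  assumes "graph_cycle (G \<restriction> S) C"
  shows "set C \<subseteq> S" "(u,v) \<in> set (vwalk_arcs C) \<Longrightarrow> u \<rightarrow>\<^bsub>G\<^esub> v" "C \<noteq> []"
  using assms by (auto simp: graph_cycle_def vwalk_def arcs_ends_induce subset_iff)

section \<open>Token sliding as a reachability relation\<close>

text \<open>A move together with the independence of both of its ends. Equal sizes along a sequence
  are recovered from \<open>ts_step_card\<close>, so sequences become the reflexive transitive
  closure of this relation.\<close>

definition ts_step :: "('a,'b) pre_digraph \<Rightarrow> 'a set \<Rightarrow> 'a set \<Rightarrow> bool" where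
  "ts_step G I J \<longleftrightarrow> independent_set G I \<and> independent_set G J \<and> ts_move G I J"

context graph begin

lemma adj_sym: "u \<rightarrow> v \<Longrightarrow> v \<rightarrow> u"
  using arcs_ends_symmetric sym_arcs by metis

lemma adj_verts: "u \<rightarrow> v \<Longrightarrow> u \<in> verts G" "u \<rightarrow> v \<Longrightarrow> v \<in> verts G"
  by (auto simp: arcs_ends_conv)

lemma independent_setD: "independent_set G I \<Longrightarrow> u \<in> I \<Longrightarrow> v \<in> I \<Longrightarrow> \<not> u \<rightarrow> v"
  by (auto simp: independent_set_def)

lemma finite_independent_set: "independent_set G I \<Longrightarrow> finite I"
  unfolding independent_set_def using finite_subset[OF _ finite_verts] by blast

lemma independent_set_subset: "independent_set G I \<Longrightarrow> J \<subseteq> I \<Longrightarrow> independent_set G J"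
  by (auto simp: independent_set_def)

lemma independent_set_insert:
  assumes "independent_set G I" "v \<in> verts G" "\<And>u. u \<in> I \<Longrightarrow> \<not> u \<rightarrow> v"
  shows "independent_set G (insert v I)"
  using assms adj_not_same adj_sym unfolding independent_set_def by blast

lemma ts_step_sym: "ts_step G I J \<Longrightarrow> ts_step G J I"
  unfolding ts_step_def ts_move_def using adj_sym by blast

lemma ts_step_card:
  assumes "ts_step G I J" shows "card I = card J"
proof -
  from assms obtain u v where "I - J = {u}" "J - I = {v}" "finite I" "finite J"
    by (auto simp: ts_step_def ts_move_def finite_independent_set)
  then have "I = insert u (I \<inter> J)" "J = insert v (I \<inter> J)" "u \<notin> I \<inter> J" "v \<notin> I \<inter> J" by auto
  then show ?thesis using \<open>finite I\<close> by (metis card_insert_disjoint finite_Int)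
qed

lemma ts_sequence_Cons_Cons:
  "ts_sequence G (X # Y # Xs) \<longleftrightarrow> ts_step G X Y \<and> ts_sequence G (Y # Xs)"
proof -
  have "(\<forall>I\<in>set (X # Y # Xs). \<forall>J\<in>set (X # Y # Xs). card I = card J) \<longleftrightarrow>
      card X = card Y \<and> (\<forall>I\<in>set (Y # Xs). \<forall>J\<in>set (Y # Xs). card I = card J)" (is "?l \<longleftrightarrow> ?r")
  proof
    assume ?r
    then have "card I = card Y" if "I \<in> set (X # Y # Xs)" for I
      using that by (metis list.set_intros(1) set_ConsD)
    then show ?l by metis
  qed (meson list.set_intros)
  then show ?thesis
    unfolding ts_sequence_def using ts_step_card[of X Y]
    by (simp only: list.set ball_simps successively.simps ts_step_def) blast
qed

text \<open>Replaces lists by a closure, so that later proofs can use rule induction. The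
  independence of \<open>I\<close> has to be stated for the case of zero moves, where the closure
  relates any set to itself.\<close>

lemma ts_reachable_iff: "ts_reachable G I J \<longleftrightarrow> independent_set G I \<and> (ts_step G)\<^sup>*\<^sup>* I J"
proof
  have "independent_set G (hd Xs) \<and> (ts_step G)\<^sup>*\<^sup>* (hd Xs) (last Xs)" if "ts_sequence G Xs" for Xs
    using that
  proof (induct Xs rule: induct_list012)
    case (3 X Y Xs)
    then have "ts_step G X Y" "(ts_step G)\<^sup>*\<^sup>* Y (last (Y # Xs))"
      by (auto simp: ts_sequence_Cons_Cons)
    then show ?case
      by (metis converse_rtranclp_into_rtranclp last_ConsR list.discI list.sel(1) ts_step_def)
  qed (auto simp: ts_sequence_def)
  then show "ts_reachable G I J \<Longrightarrow> independent_set G I \<and> (ts_step G)\<^sup>*\<^sup>* I J"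
    unfolding ts_reachable_def by blast
next
  assume "independent_set G I \<and> (ts_step G)\<^sup>*\<^sup>* I J"
  then have "(ts_step G)\<^sup>*\<^sup>* I J" and "independent_set G I" by auto
  then show "ts_reachable G I J"
  proof (induct rule: converse_rtranclp_induct)
    case base
    then show ?case unfolding ts_reachable_def
      by (intro exI[of _ "[J]"]) (auto simp: ts_sequence_def)
  next
    case (step I I')
    then obtain Is where Is: "ts_sequence G Is" "hd Is = I'" "last Is = J"
      unfolding ts_reachable_def ts_step_def by blast
    moreover from Is obtain Xs where "Is = I' # Xs" by (cases Is) (auto simp: ts_sequence_def)
    ultimately have "ts_sequence G (I # Is)" using step(1) by (simp add: ts_sequence_Cons_Cons)
    moreover have "last (I # Is) = J" using Is by (simp add: ts_sequence_def)
    ultimately show ?case unfolding ts_reachable_def by (metis list.sel(1))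
  qed
qed

lemma ts_reachable_refl: "independent_set G I \<Longrightarrow> ts_reachable G I I"
  by (simp add: ts_reachable_iff)

lemma ts_reachable_trans: "ts_reachable G I J \<Longrightarrow> ts_reachable G J K \<Longrightarrow> ts_reachable G I K"
  by (auto simp: ts_reachable_iff)

lemma ts_step_reachable: "ts_step G I J \<Longrightarrow> ts_reachable G I J"
  by (auto simp: ts_reachable_iff ts_step_def)

lemma ts_reachable_independent:
  assumes "ts_reachable G I J" shows "independent_set G J"
proof -
  have "(ts_step G)\<^sup>*\<^sup>* I J" "independent_set G I" using assms by (auto simp: ts_reachable_iff)
  then show ?thesis by (induct rule: rtranclp_induct) (auto simp: ts_step_def)
qed

lemma ts_reachable_card:
  assumes "ts_reachable G I J" shows "card I = card J"
proof -
  have "(ts_step G)\<^sup>*\<^sup>* I J" using assms by (auto simp: ts_reachable_iff)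
  then show ?thesis by (induct rule: rtranclp_induct) (auto dest: ts_step_card)
qed

lemma ts_reachable_sym:
  assumes "ts_reachable G I J" shows "ts_reachable G J I"
proof -
  have "symp (ts_step G)" by (auto intro: sympI ts_step_sym)
  then have "symp (ts_step G)\<^sup>*\<^sup>*" by (rule symp_rtranclp)
  then show ?thesis using assms ts_reachable_independent[OF assms]
    by (auto simp: ts_reachable_iff dest: sympD)
qed

lemma ts_step_swap:
  assumes "independent_set G X" "u \<in> X" "v \<notin> X" "u \<rightarrow> v" "independent_set G (insert v (X - {u}))"
  shows "ts_step G X (insert v (X - {u}))"
  unfolding ts_step_def ts_move_def using assms adj_not_same by blast

section \<open>Walk lengths, and cycles from minimum degree two\<close>

text \<open>A power of \<open>arcs_ends G\<close> records the length of a walk, which is the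
  quantity that the induction in \<open>token_jump\<close> runs on.\<close>

lemma connected_relpow:
  assumes "connected G" "x \<in> verts G" "y \<in> verts G"
  obtains n where "(x,y) \<in> arcs_ends G ^^ n"
proof -
  have "x \<rightarrow>\<^sup>*\<^bsub>G\<^esub> y"
    using assms sym_arcs unfolding connected_def strongly_connected_def
    by (simp add: reachable_mk_symmetric_eq)
  then have "(x,y) \<in> (arcs_ends G)\<^sup>*"
    unfolding reachable_def by (rule rtrancl_on_rtranclI)
  then show thesis using that rtrancl_power by metis
qed

lemma graph_cycle_degree:
  assumes "graph_cycle (G \<restriction> S) C" "w \<in> set C"
  obtains p q where "p \<in> set C" "q \<in> set C" "p \<noteq> q" "w \<rightarrow> p" "w \<rightarrow> q"
proof -
  obtain p q where pq: "p \<noteq> q" "(p,w) \<in> set (vwalk_arcs C)" "(w,q) \<in> set (vwalk_arcs C)"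
    by (rule graph_cycle_neighbours[OF assms])
  moreover have "p \<in> set C" using pq(2) by (auto elim: vwalk_arcsE)
  moreover have "q \<in> set C" using pq(3) by (auto elim: vwalk_arcsE)
  ultimately show thesis using that graph_cycle_induce(2)[OF assms(1)] adj_sym by blast
qed

text \<open>Longest path argument: every neighbour in \<open>S\<close> of the first vertex of a
  longest path lies on the path, since otherwise the path could be extended. A neighbour other than
  the second vertex closes a cycle.\<close>

lemma graph_cycle_if_min_degree_2:
  assumes S: "finite S" "S \<noteq> {}"
    and deg: "\<And>v. v \<in> S \<Longrightarrow> \<exists>a\<in>S. \<exists>b\<in>S. a \<noteq> b \<and> v \<rightarrow> a \<and> v \<rightarrow> b"
  obtains C where "graph_cycle (G \<restriction> S) C"
proof -
  let ?P = "\<lambda>p. p \<noteq> [] \<and> distinct p \<and> set p \<subseteq> S \<and> (\<forall>(u,v)\<in>set (vwalk_arcs p). u \<rightarrow> v)"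
  obtain s where "s \<in> S" using S by blast
  then have "?P [s]" by simp
  moreover have "\<forall>p. ?P p \<longrightarrow> length p < Suc (card S)"
    using S by (metis card_mono distinct_card less_Suc_eq_le)
  ultimately obtain p where p: "?P p" and max: "\<And>q. ?P q \<Longrightarrow> length q \<le> length p"
    using ex_has_greatest_nat[of ?P "[s]" length "Suc (card S)"] by blast
  obtain x q where xq: "p = x # q" using p by (cases p) auto
  obtain a b where ab: "a \<in> S" "b \<in> S" "a \<noteq> b" "x \<rightarrow> a" "x \<rightarrow> b" using deg[of x] p xq by auto
  have in_q: "z \<in> set q" if "z \<in> S" "x \<rightarrow> z" for z
  proof (rule ccontr)
    assume "z \<notin> set q"
    moreover have "z \<noteq> x" using that adj_not_same by blast
    ultimately have "?P (z # p)" using p xq that adj_sym by auto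
    from max[OF this] show False by simp
  qed
  obtain y r where yr: "q = y # r" using in_q[OF ab(1,4)] by (cases q) auto
  \<comment> \<open>One of \<open>a\<close>, \<open>b\<close> may be the second vertex
    \<open>y\<close>; the other one gives a closed walk with at least three vertices.\<close>
  obtain z where z: "z \<noteq> y" "z \<in> S" "x \<rightarrow> z" using ab by metis
  then have "z \<in> set r" using in_q yr by auto
  then obtain r1 r2 where r: "r = r1 @ z # r2" by (meson split_list)
  \<comment> \<open>Starting the list at \<open>z\<close> makes its tail a prefix of
    \<open>p\<close>, hence distinct.\<close>
  let ?C = "z # x # y # r1 @ [z]"
  have sub: "(u,v) \<in> set (vwalk_arcs p)" if uv: "(u,v) \<in> set (vwalk_arcs (x # y # r1 @ [z]))" for u v
  proof -
    obtain us vs where "x # y # r1 @ [z] = us @ u # v # vs" using uv by (rule vwalk_arcsE)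
    then have "(x # y # r1 @ [z]) @ r2 = us @ u # v # vs @ r2" by simp
    then have "p = us @ u # v # vs @ r2" using xq yr r by simp
    then show ?thesis unfolding vwalk_arcs_iff by blast
  qed
  have "graph_cycle (G \<restriction> S) ?C"
  proof -
    have vs: "set ?C \<subseteq> S" using p xq yr r by auto
    have "u \<rightarrow>\<^bsub>G \<restriction> S\<^esub> v" if uv: "(u,v) \<in> set (vwalk_arcs ?C)" for u v
    proof -
      obtain as bs where "?C = as @ u # v # bs" using uv by (rule vwalk_arcsE)
      then have "u \<in> set ?C" "v \<in> set ?C" by (simp_all only: set_append) auto
      then have "u \<in> S \<and> v \<in> S" using vs by blast
      moreover have "(u,v) = (z,x) \<or> (u,v) \<in> set (vwalk_arcs p)" using that sub by auto
      ultimately show ?thesis using z adj_sym p by (auto simp: arcs_ends_induce)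
    qed
    then have "set (vwalk_arcs ?C) \<subseteq> arcs_ends (G \<restriction> S)" by (simp add: subset_iff split_paired_all)
    then show ?thesis using vs p xq yr r by (simp add: graph_cycle_def vwalk_def)
  qed
  then show thesis using that by blast
qed

end

section \<open>Consequences of claw-freeness\<close>

locale claw_free_graph = graph +
  assumes claw_free: "claw_free G"
begin

text \<open>Otherwise \<open>x\<close> and the three vertices would induce a claw with centre
  \<open>x\<close>.\<close>

lemma claw_freeD:
  assumes "x \<rightarrow> a" "x \<rightarrow> b" "x \<rightarrow> c" "a \<noteq> b" "a \<noteq> c" "b \<noteq> c"
  shows "a \<rightarrow> b \<or> a \<rightarrow> c \<or> b \<rightarrow> c"
proof (rule ccontr)
  assume no: "\<not> ?thesis"
  let ?H = "G \<restriction> {x,a,b,c}"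
  have ind: "induced_subgraph ?H G" using assms adj_verts by (intro induced_induce) blast
  interpret H: digraph ?H by (rule digraphI_induced[OF ind])
  have "symmetric ?H" by (rule induced_graph_imp_symmetric[OF sym_arcs ind])
  then have "graph ?H" by (rule H.graphI)
  moreover have "arcs_ends ?H = {x} \<times> {a,b,c} \<union> {a,b,c} \<times> {x}"
  proof -
    have "a \<rightarrow> x" "b \<rightarrow> x" "c \<rightarrow> x" using assms by (auto intro: adj_sym)
    moreover have "\<not> b \<rightarrow> a" "\<not> c \<rightarrow> a" "\<not> c \<rightarrow> b" using no by (auto dest: adj_sym)
    moreover have "\<And>v. \<not> v \<rightarrow> v" using adj_not_same by blast
    ultimately show ?thesis using no assms(1-3) by (auto simp: arcs_ends_induce)
  qed
  moreover have "verts ?H = {x} \<union> {a,b,c}" "card {x} = 1" by auto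
  moreover have "{x} \<inter> {a,b,c} = {}" using assms(1-3) adj_not_same by blast
  moreover have "card {a,b,c} = 3" using assms by simp
  ultimately have "K\<^bsub>1,3\<^esub> ?H" unfolding complete_bipartite_digraph_def by blast
  then show False using claw_free ind unfolding claw_free_def by blast
qed

text \<open>Three distinct neighbours of \<open>x\<close> in \<open>S\<close> would be the leaves of
  a claw. Most uses of claw-freeness below go through this bound of two.\<close>

lemma independent_neighbours:
  assumes "independent_set G S" "a \<in> S" "b \<in> S" "c \<in> S" "x \<rightarrow> a" "x \<rightarrow> b" "x \<rightarrow> c"
  shows "a = b \<or> a = c \<or> b = c"
  using claw_freeD[of x a b c] independent_setD[OF assms(1)] assms by blast

lemma two_neighbours:
  assumes "independent_set G S" "p \<in> S" "q \<in> S" "p \<noteq> q" "x \<rightarrow> p" "x \<rightarrow> q"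
  shows "{s \<in> S. x \<rightarrow> s} = {p,q}"
  using assms independent_neighbours[OF assms(1-3) _ assms(5,6)] by blast

text \<open>The cycle alternates because \<open>I\<close> and \<open>J\<close> are both independent.
  It has no chord, because an end of a chord would have three neighbours in one of the two
  sets.\<close>

lemma sym_diff_cycle_bad:
  assumes I: "independent_set G I" and J: "independent_set G J"
    and C: "graph_cycle (G \<restriction> sym_diff I J) C"
  shows "bad_cycle G I C"
proof -
  note sub = graph_cycle_induce[OF C]
  have "set C \<subseteq> verts G" using sub(1) I J by (auto simp: independent_set_def)
  then have "graph_cycle G C" using C sub by (auto simp: graph_cycle_def vwalk_def)
  moreover have "card ({u,v} \<inter> I) = 1" if "(u,v) \<in> set (vwalk_arcs C)" for u v
  proof -
    have "u \<in> set C" "v \<in> set C" using that by (auto elim: vwalk_arcsE)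
    then have "u \<in> sym_diff I J" "v \<in> sym_diff I J" using sub(1) by auto
    then have "(u \<in> I \<and> v \<notin> I) \<or> (u \<notin> I \<and> v \<in> I)"
      using sub(2)[OF that] independent_setD[OF I] independent_setD[OF J] by blast
    then show ?thesis by auto
  qed
  moreover have "(u,v) \<in> set (vwalk_arcs C) \<union> (set (vwalk_arcs C))\<inverse>"
    if uv: "u \<rightarrow>\<^bsub>G \<restriction> set C\<^esub> v" for u v
  proof -
    have uv': "u \<rightarrow> v" "u \<in> set C" "v \<in> set C" using uv by (auto simp: arcs_ends_induce)
    obtain p q where pq: "p \<noteq> q" "(p,u) \<in> set (vwalk_arcs C)" "(u,q) \<in> set (vwalk_arcs C)"
      by (rule graph_cycle_neighbours[OF C uv'(2)])
    have pqC: "p \<in> set C" "q \<in> set C" using pq by (auto elim: vwalk_arcsE)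
    have adj: "u \<rightarrow> p" "u \<rightarrow> q" using pq sub(2) adj_sym by blast+
    \<comment> \<open>\<open>K\<close> is the one of \<open>I\<close> and \<open>J\<close> that does
      not contain \<open>u\<close>; all neighbours of \<open>u\<close> on the cycle lie in
      it.\<close>
    obtain K where K: "independent_set G K" "v \<in> K" "p \<in> K" "q \<in> K"
    proof (cases "u \<in> I")
      case True
      then have "{v,p,q} \<subseteq> J" using uv' pqC adj sub(1) independent_setD[OF I] by blast
      then show ?thesis using that[OF J] by blast
    next
      case False
      then have "u \<in> J" using uv'(2) sub(1) by blast
      then have "{v,p,q} \<subseteq> I" using uv' pqC adj sub(1) independent_setD[OF J] by blast
      then show ?thesis using that[OF I] by blast
    qed
    then have "v = p \<or> v = q" using independent_neighbours[OF K] uv'(1) adj pq(1) by blast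
    then show ?thesis using pq by blast
  qed
  moreover have "u \<rightarrow>\<^bsub>G \<restriction> set C\<^esub> v" if "(u,v) \<in> set (vwalk_arcs C)" for u v
  proof -
    have "u \<in> set C" "v \<in> set C" using that by (auto elim: vwalk_arcsE)
    then show ?thesis using sub(2)[OF that] by (simp add: arcs_ends_induce)
  qed
  ultimately have "graph_cycle G C" "\<forall>(u,v)\<in>set (vwalk_arcs C). card ({u,v} \<inter> I) = 1"
    and "arcs_ends (G \<restriction> set C) \<subseteq> set (vwalk_arcs C) \<union> (set (vwalk_arcs C))\<inverse>"
    and arcs: "set (vwalk_arcs C) \<subseteq> arcs_ends (G \<restriction> set C)" by auto
  moreover have "(set (vwalk_arcs C))\<inverse> \<subseteq> arcs_ends (G \<restriction> set C)"
  proof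
    fix e assume "e \<in> (set (vwalk_arcs C))\<inverse>"
    then obtain u v where "e = (v,u)" "(u,v) \<in> set (vwalk_arcs C)" by auto
    then show "e \<in> arcs_ends (G \<restriction> set C)" using arcs adj_sym arcs_ends_induce by (metis subsetD)
  qed
  ultimately show ?thesis unfolding bad_cycle_def by blast
qed

section \<open>Token jumps along shortest paths\<close>

text \<open>\<open>K\<close> consists of the tokens and the free target \<open>y\<close>. In this
  form jumps compose through any third vertex of \<open>K\<close>, which the strong induction on the
  walk length \<open>n\<close> exploits.\<close>

lemma token_jump:
  assumes K: "independent_set G K" and "x \<in> K" "y \<in> K" "(x,y) \<in> arcs_ends G ^^ n"
  shows "ts_reachable G (K - {y}) (K - {x})"
  using assms(2-)
proof (induct n arbitrary: x y rule: less_induct)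
  case (less n)
  show ?case
  proof (cases "\<exists>m<n. (x,y) \<in> arcs_ends G ^^ m")
    case True
    then show ?thesis using less by blast
  next
    \<comment> \<open>Now \<open>n\<close> is the distance from \<open>x\<close> to
      \<open>y\<close>, so the inner vertices of the walk \<open>f\<close> differ from both
      ends.\<close>
    case short: False
    obtain f where f: "f 0 = x" "f n = y" "\<And>i. i < n \<Longrightarrow> f i \<rightarrow> f (Suc i)"
      using less(4) unfolding relpow_fun_conv by blast
    have pre: "(x, f i) \<in> arcs_ends G ^^ i" if "i \<le> n" for i
      unfolding relpow_fun_conv using f that by (intro exI[of _ f]) auto
    have post: "(f i, y) \<in> arcs_ends G ^^ (n - i)" if "i \<le> n" for i
      unfolding relpow_fun_conv using f that by (intro exI[of _ "\<lambda>j. f (i + j)"]) auto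
    have nox: "f i \<noteq> x" if "0 < i" "i \<le> n" for i
      using short post[OF that(2)] that by (metis diff_less order.strict_trans2)
    have noy: "f i \<noteq> y" if "i < n" for i
      using short pre[of i] that by auto
    show ?thesis
    proof (cases "\<exists>i z. 0 < i \<and> i < n \<and> z \<in> K - {x,y} \<and> (f i = z \<or> f i \<rightarrow> z)")
      case True
      then obtain i z where i: "0 < i" "i < n" and z: "z \<in> K" "z \<noteq> x" "z \<noteq> y"
        and fz: "f i = z \<or> f i \<rightarrow> z" by blast
      have ind: "\<not> x \<rightarrow> y" "\<not> x \<rightarrow> z" "\<not> y \<rightarrow> z" "\<not> y \<rightarrow> x" "\<not> z \<rightarrow> x" "\<not> z \<rightarrow> y"
        using independent_setD[OF K] z less by auto
      have xz: "(x,z) \<in> arcs_ends G ^^ i \<or> (x,z) \<in> arcs_ends G ^^ Suc i"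
        using pre[of i] i fz by auto
      have zy: "(z,y) \<in> arcs_ends G ^^ (n - i) \<or> (z,y) \<in> arcs_ends G ^^ Suc (n - i)"
        using post[of i] i fz adj_sym relpow_Suc_I2 by (metis order_less_imp_le)
      \<comment> \<open>If \<open>z\<close> is next to \<open>f i\<close>, the detour through
        \<open>f i\<close> costs one extra arc. This stays below \<open>n\<close> on both sides
        unless \<open>i\<close> is \<open>1\<close> or \<open>n - 1\<close>; there claw-freeness at
        \<open>f i\<close> provides a shortcut.\<close>
      have "\<exists>m1<n. \<exists>m2<n. (x,z) \<in> arcs_ends G ^^ m1 \<and> (z,y) \<in> arcs_ends G ^^ m2"
      proof (cases "f i = z")
        case True
        then show ?thesis using pre[of i] post[of i] i by (metis diff_less less_imp_le order.strict_trans)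
      next
        case False
        then have fz: "f i \<rightarrow> z" using fz by blast
        consider "1 < i" "i < n - 1" | "i = 1" "n = 2" | "i = 1" "n > 2" | "i = n - 1" "n > 2"
          using i by linarith
        then show ?thesis
        proof cases
          case 1
          then have "Suc i < n" "i < n" "Suc (n - i) < n" "n - i < n" by auto
          then show ?thesis using xz zy by blast
        next
          \<comment> \<open>Impossible: \<open>x\<close>, \<open>y\<close>, \<open>z\<close> would
            be the leaves of a claw with centre \<open>f i\<close>.\<close>
          case 2
          then have "f i \<rightarrow> x" "f i \<rightarrow> y" using f(3)[of 0] f(3)[of 1] f adj_sym
            by (auto simp: numeral_2_eq_2)
          then show ?thesis using claw_freeD[of "f i" x y z] fz ind z less short i
            by (metis relpow_0_I gr_implies_not_zero neq0_conv)
        next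
          \<comment> \<open>Among the neighbours \<open>x\<close>, \<open>z\<close>,
            \<open>f 2\<close> of \<open>f 1\<close>, the vertex \<open>x\<close> is adjacent to
            neither of the others: not to \<open>z\<close> by independence and not to
            \<open>f 2\<close> by minimality of \<open>n\<close>. So \<open>z\<close> equals
            \<open>f 2\<close> or is adjacent to it, and reaches \<open>y\<close> in at most
            \<open>n - 1\<close> arcs.\<close>
          case 3
          have "f 1 \<rightarrow> x" "f 1 \<rightarrow> f 2" using f(3)[of 0] f(3)[of 1] f 3 adj_sym
            by (auto simp: numeral_2_eq_2)
          moreover have "x \<noteq> f 2" using nox[of 2] 3 by auto
          moreover have "\<not> x \<rightarrow> f 2"
          proof
            assume "x \<rightarrow> f 2"
            then have "(x,y) \<in> arcs_ends G ^^ Suc (n - 2)"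
              using post[of 2] 3 by (auto intro: relpow_Suc_I2 simp del: relpow.simps)
            then show False using short 3 by (metis Suc_diff_Suc Suc_lessD diff_less lessI numeral_2_eq_2 zero_less_Suc)
          qed
          ultimately have "z = f 2 \<or> z \<rightarrow> f 2"
            using claw_freeD[of "f 1" x z "f 2"] fz 3 z ind by blast
          then have "(z,y) \<in> arcs_ends G ^^ (n - 2) \<or> (z,y) \<in> arcs_ends G ^^ Suc (n - 2)"
            using post[of 2] 3 by (auto intro: relpow_Suc_I2 simp del: relpow.simps)
          moreover have "n - 2 < n" "Suc (n - 2) < n" "1 < n" "Suc 1 < n" using 3 by auto
          ultimately show ?thesis using xz 3 by blast
        next
          \<comment> \<open>The mirror image of the previous case, with \<open>y\<close> and
            \<open>f (i - 1)\<close> in place of \<open>x\<close> and \<open>f 2\<close>.\<close>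
          case 4
          have "f i \<rightarrow> y" "f i \<rightarrow> f (i - 1)" using f(3)[of i] f(3)[of "i - 1"] f 4 i adj_sym
            by (auto simp: Suc_diff_Suc)
          moreover have prei: "(x, f (i - 1)) \<in> arcs_ends G ^^ (i - 1)" using pre[of "i - 1"] i by simp
          moreover have "y \<noteq> f (i - 1)" using noy[of "i - 1"] i less_imp_diff_less[of i n 1] by metis
          moreover have "\<not> f (i - 1) \<rightarrow> y"
          proof
            assume "f (i - 1) \<rightarrow> y"
            then have "(x,y) \<in> arcs_ends G ^^ Suc (i - 1)"
              using relpow_Suc_I[OF prei] by blast
            then show False using short i by (metis Suc_pred' One_nat_def)
          qed
          ultimately have "z = f (i - 1) \<or> f (i - 1) \<rightarrow> z"
            using claw_freeD[of "f i" y z "f (i - 1)"] fz z ind adj_sym by blast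
          then have "(x,z) \<in> arcs_ends G ^^ (i - 1) \<or> (x,z) \<in> arcs_ends G ^^ Suc (i - 1)"
            using prei relpow_Suc_I[OF prei] by blast
          moreover have "i - 1 < n" "Suc (i - 1) < n" "n - i < n" "Suc (n - i) < n" using 4 i by auto
          ultimately show ?thesis using zy by blast
        qed
      qed
      \<comment> \<open>The token on \<open>z\<close> goes to \<open>y\<close> first; then the token
        on \<open>x\<close> goes to \<open>z\<close>.\<close>
      then have "ts_reachable G (K - {z}) (K - {x})" "ts_reachable G (K - {y}) (K - {z})"
        using less z by blast+
      then show ?thesis using ts_reachable_trans by blast
    next
      case nobad: False
      \<comment> \<open>No other token is on or next to the inner part of the path, so the token
        from \<open>x\<close> can slide along it; \<open>?X i\<close> is the position after
        \<open>i\<close> moves.\<close>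
      let ?X = "\<lambda>i. insert (f i) (K - {x,y})"
      have notin: "f i \<notin> K - {x,y}" if "i \<le> n" for i
      proof (cases "i = 0 \<or> i = n")
        case False
        then have "0 < i" "i < n" using that by auto
        then show ?thesis using nobad by blast
      qed (use f in auto)
      have nadj: "\<not> f i \<rightarrow> z" if "i \<le> n" "z \<in> K - {x,y}" for i z
      proof (cases "i = 0 \<or> i = n")
        case True
        then show ?thesis using f that less independent_setD[OF K] by auto
      next
        case False
        then have "0 < i" "i < n" using that by auto
        then show ?thesis using nobad that by blast
      qed
      show ?thesis
      proof (cases "n = 0")
        case True
        then show ?thesis using f ts_reachable_refl independent_set_subset[OF K] by (metis Diff_subset)
      next
        case n: False
        have ind: "independent_set G (?X i)" if "i \<le> n" for i
        proof (rule independent_set_insert)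
          show "independent_set G (K - {x,y})" using independent_set_subset[OF K] by blast
          show "f i \<in> verts G"
          proof (cases "i = n")
            case True
            then show ?thesis using f less K by (auto simp: independent_set_def)
          next
            case False
            then show ?thesis using f(3)[of i] that adj_verts by auto
          qed
          show "\<not> z \<rightarrow> f i" if "z \<in> K - {x,y}" for z using nadj \<open>i \<le> n\<close> that adj_sym by blast
        qed
        have "ts_reachable G (?X 0) (?X i)" if "i \<le> n" for i
          using that
        proof (induct i)
          case 0
          then show ?case using ind by (simp add: ts_reachable_refl)
        next
          case (Suc i)
          have eq: "?X (Suc i) = insert (f (Suc i)) (?X i - {f i})" using notin[of i] Suc by auto
          have "f i \<noteq> f (Suc i)" using f(3)[of i] Suc adj_not_same by auto
          then have "ts_step G (?X i) (?X (Suc i))"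
            unfolding eq using ind[of i] ind[of "Suc i"] notin[of "Suc i"] f(3)[of i] Suc eq
            by (intro ts_step_swap) auto
          then show ?case using Suc ts_step_reachable ts_reachable_trans by (metis Suc_leD)
        qed
        moreover have "x \<noteq> y" using noy[of 0] n f by auto
        then have "?X 0 = K - {y}" "?X n = K - {x}" using f less by auto
        ultimately show ?thesis by (metis order_refl)
      qed
    qed
  qed
qed

section \<open>Rings of tokens around an independent set\<close>

definition away :: "'a set \<Rightarrow> 'a set \<Rightarrow> 'a set" where
  "away B X = {a \<in> X. \<forall>b\<in>B. \<not> a \<rightarrow> b}"

text \<open>
  When $G[X \cup B]$ contains a chordless cycle alternating between $X$ and $B$ and covering $B$,
  all three conditions hold. They mention neither the set of cycle vertices in $X$ nor a cyclic
  order, so that only neighbourhoods in $B$ have to be compared when a token moves; the last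
  condition says that $B$ lies on one cycle.
\<close>

definition ring_around :: "'a set \<Rightarrow> 'a set \<Rightarrow> bool" where
  "ring_around B X \<longleftrightarrow> (\<forall>a\<in>X. \<forall>b\<in>B. a \<rightarrow> b \<longrightarrow> (\<exists>b'\<in>B. b' \<noteq> b \<and> a \<rightarrow> b'))
     \<and> (\<forall>b\<in>B. \<exists>p\<in>X. \<exists>q\<in>X. p \<noteq> q \<and> b \<rightarrow> p \<and> b \<rightarrow> q)
     \<and> (\<forall>S. S \<subset> B \<and> S \<noteq> {} \<longrightarrow> (\<exists>a\<in>X. \<exists>s\<in>S. \<exists>t\<in>B - S. a \<rightarrow> s \<and> a \<rightarrow> t))"

lemma ring_aroundD:
  assumes "ring_around B X"
  shows "\<And>a b. a \<in> X \<Longrightarrow> b \<in> B \<Longrightarrow> a \<rightarrow> b \<Longrightarrow> \<exists>b'\<in>B. b' \<noteq> b \<and> a \<rightarrow> b'"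
    and "\<And>b. b \<in> B \<Longrightarrow> \<exists>p\<in>X. \<exists>q\<in>X. p \<noteq> q \<and> b \<rightarrow> p \<and> b \<rightarrow> q"
    and "\<And>S. S \<subset> B \<Longrightarrow> S \<noteq> {} \<Longrightarrow> \<exists>a\<in>X. \<exists>s\<in>S. \<exists>t\<in>B - S. a \<rightarrow> s \<and> a \<rightarrow> t"
  using assms unfolding ring_around_def by blast+

text \<open>\<open>away B X \<union> B\<close> is the position in which the tokens near
  \<open>B\<close> have been carried onto \<open>B\<close> and the others stay. This set is followed
  along a resolving sequence.\<close>

lemma independent_away:
  assumes "independent_set G B" "independent_set G X"
  shows "independent_set G (away B X \<union> B)"
  using assms adj_sym unfolding independent_set_def away_def by blast

lemma ring_around_disjoint:
  assumes "independent_set G X" "ring_around B X"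
  shows "X \<inter> B = {}"
  using ring_aroundD(2)[OF assms(2)] independent_setD[OF assms(1)] by blast

text \<open>Double counting of the edges between \<open>B\<close> and the tokens next to
  \<open>B\<close>: on both sides every vertex has at least two neighbours on the other side by
  \<open>ring_around\<close>, and at most two by claw-freeness. So there are as many such tokens as
  vertices in \<open>B\<close>.\<close>

lemma card_away:
  assumes B: "independent_set G B" and X: "independent_set G X" and ring: "ring_around B X"
  shows "card X = card (away B X \<union> B)"
proof -
  let ?A = "{a \<in> X. \<exists>b\<in>B. a \<rightarrow> b}"
  have fin: "finite B" "finite X" using B X finite_independent_set by auto
  have "card {b \<in> B. a \<rightarrow> b} = 2" if "a \<in> ?A" for a
  proof -
    obtain b b' where "b \<in> B" "b' \<in> B" "b' \<noteq> b" "a \<rightarrow> b" "a \<rightarrow> b'"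
      using \<open>a \<in> ?A\<close> ring_aroundD(1)[OF ring] by blast
    then show ?thesis using two_neighbours[OF B, of b b' a] by simp
  qed
  moreover have "card {a \<in> ?A. a \<rightarrow> b} = 2" if "b \<in> B" for b
  proof -
    obtain p q where "p \<in> X" "q \<in> X" "p \<noteq> q" "b \<rightarrow> p" "b \<rightarrow> q"
      using \<open>b \<in> B\<close> ring_aroundD(2)[OF ring] by blast
    moreover have "{a \<in> ?A. a \<rightarrow> b} = {a \<in> X. b \<rightarrow> a}" using \<open>b \<in> B\<close> adj_sym by blast
    ultimately show ?thesis using two_neighbours[OF X, of p q b] by simp
  qed
  ultimately have "(\<Sum>a\<in>?A. 2) = 2 * card B"
    using sum_multicount[of ?A B "\<lambda>a b. a \<rightarrow> b" 2] fin by simp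
  then have "card ?A = card B" by simp
  moreover have "card (away B X \<union> ?A) = card (away B X) + card ?A"
    using fin by (intro card_Un_disjoint) (auto simp: away_def)
  moreover have "away B X \<union> ?A = X" by (auto simp: away_def)
  moreover have "away B X \<inter> B = {}" using ring_around_disjoint[OF X ring] by (auto simp: away_def)
  then have "card (away B X \<union> B) = card (away B X) + card B"
    using fin by (intro card_Un_disjoint) (auto simp: away_def)
  ultimately show ?thesis by simp
qed

end

section \<open>The acyclic case\<close>

locale connected_claw_free_graph = claw_free_graph +
  assumes connected: "connected G"
begin

text \<open>Induction on \<open>card (I - J)\<close>. Each step replaces \<open>I\<close> or
  \<open>J\<close> by a reachable set without adding vertices to the symmetric difference, so no
  cycle can arise.\<close>

lemma acyclic_reachable:
  assumes "independent_set G I" "independent_set G J" "card I = card J"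
    and "\<nexists>C. graph_cycle (G \<restriction> sym_diff I J) C"
  shows "ts_reachable G I J"
  using assms
proof (induct "card (I - J)" arbitrary: I J rule: less_induct)
  case less
  note I = less.prems(1) and J = less.prems(2)
  note fin = finite_independent_set[OF I] finite_independent_set[OF J]
  \<comment> \<open>The move from \<open>x\<close> to \<open>y\<close> when \<open>x\<close> is the
    only neighbour of \<open>y\<close> in \<open>I\<close>. It is stated for arbitrary sets in order
    to be applied with \<open>I\<close> and \<open>J\<close> exchanged in case
    \<open>b\<close>.\<close>
  have slide: "independent_set G (insert y (I - {x}))" "card (insert y (I - {x}) - J) < card (I - J)"
      "ts_reachable G I (insert y (I - {x}))" "sym_diff (insert y (I - {x})) J \<subseteq> sym_diff I J"
    if I: "independent_set G I" and J: "independent_set G J"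
      and y: "y \<in> J - I" "x \<in> I" "y \<rightarrow> x" "\<And>z. z \<in> I \<Longrightarrow> y \<rightarrow> z \<Longrightarrow> z = x" for I J x y
  proof -
    have x: "x \<notin> J" using y independent_setD[OF J] by blast
    show ind: "independent_set G (insert y (I - {x}))"
    proof (rule independent_set_insert)
      show "independent_set G (I - {x})" using independent_set_subset[OF I] by blast
      show "y \<in> verts G" using y adj_verts by blast
      show "\<not> z \<rightarrow> y" if "z \<in> I - {x}" for z using that y adj_sym by blast
    qed
    have "insert y (I - {x}) - J = (I - J) - {x}" using y(1) x by auto
    moreover have "x \<in> I - J" "finite (I - J)" using y(2) x finite_independent_set[OF I] by auto
    ultimately show "card (insert y (I - {x}) - J) < card (I - J)" by (metis card_Diff1_less)
    show "ts_reachable G I (insert y (I - {x}))"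
      using ts_step_swap[OF I _ _ _ ind] y adj_sym ts_step_reachable by blast
    show "sym_diff (insert y (I - {x})) J \<subseteq> sym_diff I J" using y(1,2) x by auto
  qed
  show ?case
  proof (cases "I = J")
    case True
    then show ?thesis using I ts_reachable_refl by simp
  next
    case neq: False
    have card_diff: "card (I - J) = card (J - I)"
      using less.prems(3) fin by (metis card_le_sym_Diff le_antisym order_refl)
    \<comment> \<open>In case \<open>c\<close> no vertex of the symmetric difference has exactly one
      neighbour in the opposite set.\<close>
    consider (a) x y where "y \<in> J - I" "x \<in> I" "y \<rightarrow> x" "\<And>z. z \<in> I \<Longrightarrow> y \<rightarrow> z \<Longrightarrow> z = x"
      | (b) x y where "x \<in> I - J" "y \<in> J" "x \<rightarrow> y" "\<And>z. z \<in> J \<Longrightarrow> x \<rightarrow> z \<Longrightarrow> z = y"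
      | (c) "\<And>x y. y \<in> J - I \<Longrightarrow> x \<in> I \<Longrightarrow> y \<rightarrow> x \<Longrightarrow> \<exists>z\<in>I. z \<noteq> x \<and> y \<rightarrow> z"
            "\<And>x y. x \<in> I - J \<Longrightarrow> y \<in> J \<Longrightarrow> x \<rightarrow> y \<Longrightarrow> \<exists>z\<in>J. z \<noteq> y \<and> x \<rightarrow> z"
      by metis
    then show ?thesis
    proof cases
      case a
      note s = slide[OF I J a]
      have "\<nexists>C. graph_cycle (G \<restriction> sym_diff (insert y (I - {x})) J) C"
        using less.prems(4) graph_cycle_mono[OF _ s(4)] by blast
      moreover have "card (insert y (I - {x})) = card J"
        using ts_reachable_card[OF s(3)] less.prems(3) by simp
      ultimately have "ts_reachable G (insert y (I - {x})) J"
        using less.hyps[OF s(2,1) J] by blast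
      then show ?thesis using s(3) ts_reachable_trans by blast
    next
      \<comment> \<open>Here \<open>J\<close> is moved towards \<open>I\<close>, and reversibility
        of moves gives the result. The slide shrinks \<open>J - I\<close>; equal cardinalities
        transfer this to \<open>I - J\<close>.\<close>
      case b
      note s = slide[OF J I b]
      have "\<nexists>C. graph_cycle (G \<restriction> sym_diff I (insert x (J - {y}))) C"
        using less.prems(4) graph_cycle_mono[OF _ s(4)] by (metis Un_commute)
      moreover have c: "card I = card (insert x (J - {y}))"
        using ts_reachable_card[OF s(3)] less.prems(3) by simp
      moreover have "card (I - insert x (J - {y})) < card (I - J)"
      proof -
        have "card (I - insert x (J - {y})) = card (insert x (J - {y}) - I)"
          using c fin finite_independent_set[OF s(1)] by (metis card_le_sym_Diff le_antisym order_refl)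
        then show ?thesis using s(2) card_diff by simp
      qed
      ultimately have "ts_reachable G I (insert x (J - {y}))"
        using less.hyps[OF _ I s(1)] by blast
      then show ?thesis using s(3) ts_reachable_trans ts_reachable_sym by blast
    next
      case c
      \<comment> \<open>The non-isolated vertices of the symmetric difference. By \<open>c\<close>
        each of them has two neighbours among them, so a nonempty \<open>?S\<close> would contain a
        cycle.\<close>
      let ?S = "{v \<in> sym_diff I J. \<exists>w \<in> sym_diff I J. v \<rightarrow> w}"
      have "?S = {}"
      proof (rule ccontr)
        assume ne: "?S \<noteq> {}"
        have "finite ?S" using fin by simp
        moreover note ne
        moreover have "\<exists>a\<in>?S. \<exists>b\<in>?S. a \<noteq> b \<and> v \<rightarrow> a \<and> v \<rightarrow> b" if v: "v \<in> ?S" for v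
        proof -
          obtain w where w: "v \<in> sym_diff I J" "w \<in> sym_diff I J" "v \<rightarrow> w" using v by blast
          have "\<exists>z\<in>sym_diff I J. z \<noteq> w \<and> v \<rightarrow> z"
          proof (cases "v \<in> I")
            case True
            then have "v \<in> I - J" "w \<in> J" using w independent_setD[OF I] by blast+
            then obtain z where "z \<in> J" "z \<noteq> w" "v \<rightarrow> z" using c(2) w by blast
            then show ?thesis using True independent_setD[OF I] by blast
          next
            case False
            then have "v \<in> J - I" "w \<in> I" using w independent_setD[OF J] by blast+
            then obtain z where "z \<in> I" "z \<noteq> w" "v \<rightarrow> z" using c(1) w by blast
            then show ?thesis using \<open>v \<in> J - I\<close> independent_setD[OF J] by blast
          qed
          then obtain z where "z \<in> sym_diff I J" "z \<noteq> w" "v \<rightarrow> z" by blast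
          then have "z \<in> ?S" "w \<in> ?S" using w adj_sym by blast+
          then show ?thesis using \<open>z \<noteq> w\<close> \<open>v \<rightarrow> z\<close> w(3) by blast
        qed
        ultimately obtain C where "graph_cycle (G \<restriction> ?S) C"
          by (rule graph_cycle_if_min_degree_2)
        moreover have "?S \<subseteq> sym_diff I J" by blast
        ultimately show False using graph_cycle_mono less.prems(4) by blast
      qed
      \<comment> \<open>Without edges between \<open>I\<close> and \<open>J\<close> the set
        \<open>insert y I\<close> is independent, as \<open>token_jump\<close> requires.\<close>
      then have nadj: "\<not> x \<rightarrow> y" if "x \<in> I" "y \<in> J" for x y
        using that independent_setD[OF I] independent_setD[OF J] by blast
      have "I - J \<noteq> {}" using neq card_diff fin by (metis Diff_eq_empty_iff card_0_eq card.empty finite_Diff subset_antisym)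
      then have "J - I \<noteq> {}" using card_diff fin by (metis card_0_eq card.empty finite_Diff)
      then obtain x y where xy: "x \<in> I - J" "y \<in> J - I" using \<open>I - J \<noteq> {}\<close> by blast
      have yv: "y \<in> verts G" using xy J by (auto simp: independent_set_def)
      have K: "independent_set G (insert y I)"
        using independent_set_insert[OF I yv] nadj xy by blast
      have "x \<in> verts G" using xy I by (auto simp: independent_set_def)
      then obtain n where "(x,y) \<in> arcs_ends G ^^ n"
        using connected_relpow[OF connected _ yv] by blast
      then have "ts_reachable G (insert y I - {y}) (insert y I - {x})"
        using token_jump[OF K] xy by blast
      moreover have "insert y I - {y} = I" using xy by auto
      ultimately have r: "ts_reachable G I (insert y I - {x})" by simp
      have "insert y I - {x} - J = (I - J) - {x}" using xy by auto
      then have "card (insert y I - {x} - J) < card (I - J)"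
        using xy fin by (metis card_Diff1_less finite_Diff)
      moreover have "sym_diff (insert y I - {x}) J \<subseteq> sym_diff I J" using xy by auto
      then have "\<nexists>C. graph_cycle (G \<restriction> sym_diff (insert y I - {x}) J) C"
        using less.prems(4) graph_cycle_mono by blast
      moreover have "card (insert y I - {x}) = card J"
        using ts_reachable_card[OF r] less.prems(3) by simp
      ultimately have "ts_reachable G (insert y I - {x}) J"
        using less.hyps ts_reachable_independent[OF r] J by blast
      then show ?thesis using r ts_reachable_trans by blast
    qed
  qed
qed

section \<open>Following a resolving sequence\<close>

text \<open>The effect of one move. Either the ring survives and the position with its tokens on
  \<open>B\<close> changes by at most the same move, or the ring breaks and its tokens can be
  carried onto \<open>B\<close> by the acyclic case.\<close>

lemma ring_around_step:
  assumes B: "independent_set G B" and ring: "ring_around B X" and step: "ts_step G X X'"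
  shows "ring_around B X' \<and> ts_reachable G (away B X \<union> B) (away B X' \<union> B)
    \<or> ts_reachable G X' (away B X \<union> B)"
proof -
  have X: "independent_set G X" and X': "independent_set G X'" using step by (auto simp: ts_step_def)
  obtain u v where uv: "u \<rightarrow> v" "X - X' = {u}" "X' - X = {v}"
    using step by (auto simp: ts_step_def ts_move_def)
  have eq: "X' = insert v (X - {u})" and u: "u \<in> X" "u \<notin> X'" and v: "v \<in> X'" "v \<notin> X" using uv by blast+
  have disj: "X \<inter> B = {}" using ring_around_disjoint[OF X ring] .
  have indep_BX: "independent_set G (away B X \<union> B)" using independent_away[OF B X] .
  have vB: "v \<notin> B" using ring_aroundD(2)[OF ring, of v] independent_setD[OF X' v(1)] eq by blast
  \<comment> \<open>The move brings no new contact with \<open>B\<close>: if \<open>u\<close> were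
    not a neighbour of \<open>b\<close>, both neighbours of \<open>b\<close> in \<open>X\<close>
    would remain, and with \<open>v\<close> there would be three in \<open>X'\<close>.\<close>
  have nb: "u \<rightarrow> b" if b: "b \<in> B" "v \<rightarrow> b" for b
  proof (rule ccontr)
    assume "\<not> u \<rightarrow> b"
    moreover obtain p q where pq: "p \<in> X" "q \<in> X" "p \<noteq> q" "b \<rightarrow> p" "b \<rightarrow> q"
      using ring_aroundD(2)[OF ring b(1)] by blast
    ultimately have "p \<in> X'" "q \<in> X'" using eq adj_sym by blast+
    then show False using independent_neighbours[OF X' _ _ v(1) pq(4,5)] b pq v adj_sym by blast
  qed
  show ?thesis
  proof (cases "\<exists>b\<in>B. u \<rightarrow> b")
    \<comment> \<open>The moving token is away from \<open>B\<close> before and after the move, so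
      the ring is untouched and \<open>away B X\<close> makes the same move.\<close>
    case False
    then have nu: "\<not> u \<rightarrow> b" "\<not> v \<rightarrow> b" "\<not> b \<rightarrow> u" if "b \<in> B" for b using nb that adj_sym by blast+
    have "ring_around B X'" unfolding ring_around_def
    proof (intro conjI ballI allI impI)
      fix a b assume "a \<in> X'" "b \<in> B" "a \<rightarrow> b"
      then show "\<exists>b'\<in>B. b' \<noteq> b \<and> a \<rightarrow> b'" using ring_aroundD(1)[OF ring, of a b] nu eq by blast
    next
      fix b assume "b \<in> B"
      then obtain p q where "p \<in> X" "q \<in> X" "p \<noteq> q" "b \<rightarrow> p" "b \<rightarrow> q"
        using ring_aroundD(2)[OF ring] by blast
      moreover from this \<open>b \<in> B\<close> have "p \<in> X'" "q \<in> X'" using nu eq by blast+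
      ultimately show "\<exists>p\<in>X'. \<exists>q\<in>X'. p \<noteq> q \<and> b \<rightarrow> p \<and> b \<rightarrow> q" by blast
    next
      fix S assume "S \<subset> B \<and> S \<noteq> {}"
      then obtain a s t where "a \<in> X" "s \<in> S" "t \<in> B - S" "a \<rightarrow> s" "a \<rightarrow> t"
        using ring_aroundD(3)[OF ring] by blast
      moreover from this have "a \<in> X'" using nu eq by blast
      ultimately show "\<exists>a\<in>X'. \<exists>s\<in>S. \<exists>t\<in>B - S. a \<rightarrow> s \<and> a \<rightarrow> t" by blast
    qed
    moreover have "u \<in> away B X" using u nu by (auto simp: away_def)
    moreover have "away B X' \<union> B = insert v ((away B X \<union> B) - {u})"
      using eq nu u disj by (auto simp: away_def)
    moreover have "v \<notin> away B X \<union> B" using v vB by (auto simp: away_def)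
    ultimately show ?thesis
      using ts_step_swap[OF indep_BX, of u v] independent_away[OF B X'] uv(1) ts_step_reachable
      by (metis UnI1)
  next
    case True
    then obtain b1 b2 where b: "b1 \<in> B" "b2 \<in> B" "b2 \<noteq> b1" "u \<rightarrow> b1" "u \<rightarrow> b2"
      using ring_aroundD(1)[OF ring u(1)] by blast
    have ub: "b = b1 \<or> b = b2" if "b \<in> B" "u \<rightarrow> b" for b
      using independent_neighbours[OF B b(1,2) that(1) b(4,5) that(2)] b(3) by blast
    have vb: "v \<rightarrow> b1 \<or> v \<rightarrow> b2"
      using claw_freeD[of u b1 b2 v] b uv(1) vB independent_setD[OF B b(1,2)] adj_sym by blast
    show ?thesis
    proof (cases "v \<rightarrow> b1 \<and> v \<rightarrow> b2")
      \<comment> \<open>The vertex \<open>v\<close> takes over both ring neighbours of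
        \<open>u\<close>, so it replaces \<open>u\<close> in the ring and \<open>away\<close> is
        unchanged.\<close>
      case both: True
      then have same: "u \<rightarrow> b \<longleftrightarrow> v \<rightarrow> b" if "b \<in> B" for b using that nb ub by blast
      then have same': "b \<rightarrow> u \<longleftrightarrow> b \<rightarrow> v" if "b \<in> B" for b using that adj_sym by blast
      have "ring_around B X'" unfolding ring_around_def
      proof (intro conjI ballI allI impI)
        fix a b assume "a \<in> X'" "b \<in> B" "a \<rightarrow> b"
        then show "\<exists>b'\<in>B. b' \<noteq> b \<and> a \<rightarrow> b'"
          using ring_aroundD(1)[OF ring, of a b] ring_aroundD(1)[OF ring, of u b] u same eq by blast
      next
        fix b assume "b \<in> B"
        then obtain p q where pq: "p \<in> X" "q \<in> X" "p \<noteq> q" "b \<rightarrow> p" "b \<rightarrow> q"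
          using ring_aroundD(2)[OF ring] by blast
        let ?f = "\<lambda>x. if x = u then v else x"
        have "?f p \<in> X'" "?f q \<in> X'" "?f p \<noteq> ?f q" "b \<rightarrow> ?f p" "b \<rightarrow> ?f q"
          using pq same'[OF \<open>b \<in> B\<close>] eq v by auto
        then show "\<exists>p\<in>X'. \<exists>q\<in>X'. p \<noteq> q \<and> b \<rightarrow> p \<and> b \<rightarrow> q" by blast
      next
        fix S assume S: "S \<subset> B \<and> S \<noteq> {}"
        then obtain a s t where "a \<in> X" "s \<in> S" "t \<in> B - S" "a \<rightarrow> s" "a \<rightarrow> t"
          using ring_aroundD(3)[OF ring] by blast
        then show "\<exists>a\<in>X'. \<exists>s\<in>S. \<exists>t\<in>B - S. a \<rightarrow> s \<and> a \<rightarrow> t"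
          using eq same S by (cases "a = u") blast+
      qed
      moreover have "away B X' = away B X"
        using eq same b u by (auto simp: away_def)
      ultimately show ?thesis using ts_reachable_refl[OF indep_BX] by simp
    next
      case False
      then obtain c d where cd: "c \<in> B" "d \<in> B" "u \<rightarrow> c" "u \<rightarrow> d" "v \<rightarrow> c" "\<not> v \<rightarrow> d"
        and ucd: "\<And>b. b \<in> B \<Longrightarrow> u \<rightarrow> b \<Longrightarrow> b = c \<or> b = d"
        using vb b ub by metis
      \<comment> \<open>The contact between the moving token and \<open>d\<close> is lost. A
        remaining cycle \<open>D\<close> would miss \<open>d\<close>, yet could not stop before
        reaching all of \<open>B\<close>.\<close>
      have "\<nexists>D. graph_cycle (G \<restriction> sym_diff X' (away B X \<union> B)) D"
      proof
        assume "\<exists>D. graph_cycle (G \<restriction> sym_diff X' (away B X \<union> B)) D"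
        then obtain D where D: "graph_cycle (G \<restriction> sym_diff X' (away B X \<union> B)) D" by blast
        have sub: "set D \<subseteq> X' \<union> B"
        proof -
          have "u \<notin> away B X" using cd by (auto simp: away_def)
          then have "away B X \<subseteq> X'" using eq by (auto simp: away_def)
          then show ?thesis using graph_cycle_induce(1)[OF D] by blast
        qed
        have degB: "\<exists>p\<in>set D \<inter> X'. \<exists>q\<in>set D \<inter> X'. p \<noteq> q \<and> w \<rightarrow> p \<and> w \<rightarrow> q"
          if w: "w \<in> set D" "w \<in> B" for w
        proof -
          obtain p q where "p \<in> set D" "q \<in> set D" "p \<noteq> q" "w \<rightarrow> p" "w \<rightarrow> q"
            by (rule graph_cycle_degree[OF D w(1)])
          then show ?thesis using sub that independent_setD[OF B] by blast
        qed
        have degX: "\<exists>p\<in>set D \<inter> B. \<exists>q\<in>set D \<inter> B. p \<noteq> q \<and> w \<rightarrow> p \<and> w \<rightarrow> q"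
          if w: "w \<in> set D" "w \<in> X'" for w
        proof -
          obtain p q where "p \<in> set D" "q \<in> set D" "p \<noteq> q" "w \<rightarrow> p" "w \<rightarrow> q"
            by (rule graph_cycle_degree[OF D w(1)])
          then show ?thesis using sub that independent_setD[OF X'] by blast
        qed
        \<comment> \<open>Two neighbours of \<open>d\<close> in \<open>X'\<close> would both be in
          \<open>X - {u}\<close>, giving \<open>d\<close> three neighbours in \<open>X\<close>
          together with \<open>u\<close>.\<close>
        have dD: "d \<notin> set D"
        proof
          assume "d \<in> set D"
          then obtain p q where pq: "p \<in> X'" "q \<in> X'" "p \<noteq> q" "d \<rightarrow> p" "d \<rightarrow> q" using degB cd by blast
          then have "p \<in> X" "q \<in> X" using eq cd adj_sym by blast+
          then show False
            using independent_neighbours[OF X _ _ u(1) pq(4,5)] pq cd u adj_sym by blast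
        qed
        let ?S = "set D \<inter> B"
        obtain w where w: "w \<in> set D" using graph_cycle_induce(3)[OF D] by fastforce
        have "?S \<noteq> {}"
        proof (cases "w \<in> B")
          case True
          then show ?thesis using w by blast
        next
          case False
          then have "w \<in> X'" using w sub by blast
          from degX[OF w this] show ?thesis by blast
        qed
        moreover have "?S \<subset> B" using dD cd(2) by blast
        \<comment> \<open>The ring links the part of \<open>B\<close> on \<open>D\<close> to the
          rest through a token \<open>a\<close>.\<close>
        ultimately obtain a s t where a: "a \<in> X" "s \<in> ?S" "t \<in> B - ?S" "a \<rightarrow> s" "a \<rightarrow> t"
          using ring_aroundD(3)[OF ring] by meson
        obtain p q where pq: "p \<in> set D" "q \<in> set D" "p \<in> X'" "q \<in> X'" "p \<noteq> q" "s \<rightarrow> p" "s \<rightarrow> q"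
          using degB a(2) by blast
        \<comment> \<open>The token \<open>a\<close> after the move. It is next to \<open>s\<close>,
          whose two neighbours in \<open>X'\<close> lie on \<open>D\<close>, so \<open>a'\<close>
          lies on \<open>D\<close> and has two neighbours in \<open>B\<close> there. With
          \<open>t\<close> this is one too many for \<open>a\<close>; for \<open>a = u\<close> only
          \<open>c\<close> is available on \<open>D\<close>.\<close>
        define a' where "a' = (if a = u then v else a)"
        have "s = c" if "a = u" using ucd a that dD by blast
        then have "a' \<in> X'" "s \<rightarrow> a'" using a eq cd adj_sym by (auto simp: a'_def)
        then have "a' \<in> set D"
          using independent_neighbours[OF X' pq(3,4) _ pq(6,7)] pq by blast
        then obtain p' q' where pq': "p' \<in> ?S" "q' \<in> ?S" "p' \<noteq> q'" "a' \<rightarrow> p'" "a' \<rightarrow> q'"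
          using degX \<open>a' \<in> X'\<close> by blast
        show False
        proof (cases "a = u")
          case True
          then have "u \<rightarrow> p'" "u \<rightarrow> q'" using nb pq' by (auto simp: a'_def)
          then show False using ucd pq' dD by blast
        next
          case False
          then have "a \<rightarrow> p'" "a \<rightarrow> q'" using pq' by (auto simp: a'_def)
          then show False using independent_neighbours[OF B, of p' q' t a] pq' a by blast
        qed
      qed
      moreover have "card X' = card (away B X \<union> B)"
        using ts_step_card[OF step] card_away[OF B X ring] by simp
      ultimately show ?thesis using acyclic_reachable[OF X' indep_BX] by blast
    qed
  qed
qed

text \<open>Induction along a resolving sequence. The cycle gives a ring at the start, acyclicity
  excludes one at the end, and \<open>ring_around_step\<close> handles each move in between.\<close>

lemma resolve_cycle:
  assumes I: "independent_set G I" and J: "independent_set G J"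
    and C: "graph_cycle (G \<restriction> sym_diff I J) C" and res: "resolvable G I C"
  shows "ts_reachable G I ((I - set C) \<union> (set C - I))"
proof -
  let ?B = "set C - I"
  note sub = graph_cycle_induce[OF C]
  have BJ: "?B \<subseteq> J" using sub(1) by blast
  have B: "independent_set G ?B" using independent_set_subset[OF J BJ] .
  have degB: "\<exists>p\<in>set C \<inter> I. \<exists>q\<in>set C \<inter> I. p \<noteq> q \<and> w \<rightarrow> p \<and> w \<rightarrow> q" if w: "w \<in> ?B" for w
  proof -
    obtain p q where "p \<in> set C" "q \<in> set C" "p \<noteq> q" "w \<rightarrow> p" "w \<rightarrow> q"
      using graph_cycle_degree[OF C, of w] w by blast
    then show ?thesis using BJ that independent_setD[OF B] by blast
  qed
  have degI: "\<exists>p\<in>?B. \<exists>q\<in>?B. p \<noteq> q \<and> w \<rightarrow> p \<and> w \<rightarrow> q" if w: "w \<in> set C \<inter> I" for w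
  proof -
    obtain p q where "p \<in> set C" "q \<in> set C" "p \<noteq> q" "w \<rightarrow> p" "w \<rightarrow> q"
      using graph_cycle_degree[OF C, of w] w by blast
    then show ?thesis using that independent_setD[OF I] by blast
  qed
  have inC: "a \<in> set C" if ab: "a \<in> I" "b \<in> ?B" "a \<rightarrow> b" for a b
  proof -
    obtain p q where pq: "p \<in> set C \<inter> I" "q \<in> set C \<inter> I" "p \<noteq> q" "b \<rightarrow> p" "b \<rightarrow> q"
      using degB[OF ab(2)] by blast
    then show ?thesis using independent_neighbours[OF I, of p q a b] that adj_sym by blast
  qed
  obtain w where w: "w \<in> set C" using sub(3) by fastforce
  have Bne: "?B \<noteq> {}"
  proof (cases "w \<in> I")
    case True
    with w degI[of w] show ?thesis by blast
  qed (use w in blast)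
  have ring: "ring_around ?B I" unfolding ring_around_def
  proof (intro conjI ballI allI impI)
    fix a b assume "a \<in> I" "b \<in> ?B" "a \<rightarrow> b"
    then show "\<exists>b'\<in>?B. b' \<noteq> b \<and> a \<rightarrow> b'" using inC degI[of a] by (metis IntI)
  next
    fix b assume "b \<in> ?B"
    then show "\<exists>p\<in>I. \<exists>q\<in>I. p \<noteq> q \<and> b \<rightarrow> p \<and> b \<rightarrow> q" using degB by blast
  next
    fix S assume S: "S \<subset> ?B \<and> S \<noteq> {}"
    show "\<exists>a\<in>I. \<exists>s\<in>S. \<exists>t\<in>?B - S. a \<rightarrow> s \<and> a \<rightarrow> t"
    proof (rule ccontr)
      assume no: "\<not> ?thesis"
      \<comment> \<open>\<open>S\<close> with its neighbours in \<open>I\<close> on the cycle. If no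
        token joins \<open>S\<close> to the rest of \<open>B\<close>, this set is closed under
        adjacency within \<open>C\<close>, hence contains all of \<open>C\<close>, which contradicts
        \<open>S \<subset> B\<close>.\<close>
      let ?T = "S \<union> {a \<in> I \<inter> set C. \<exists>s\<in>S. a \<rightarrow> s}"
      have closed: "y \<in> ?T" if xy: "x \<in> ?T" "y \<in> set C" "x \<rightarrow> y" for x y
      proof (cases "x \<in> S")
        case True
        then have "y \<in> I" using that independent_setD[OF B, of x y] S by blast
        then show ?thesis using True that adj_sym by blast
      next
        case False
        then obtain s where "x \<in> I" "s \<in> S" "x \<rightarrow> s" using xy by blast
        moreover have "y \<in> ?B" using \<open>x \<in> I\<close> that independent_setD[OF I] by blast
        ultimately show ?thesis using no that by blast
      qed
      have "set C \<subseteq> ?T"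
      proof (rule vwalk_closed)
        show "x \<in> ?T \<longleftrightarrow> y \<in> ?T" if xy: "(x,y) \<in> set (vwalk_arcs C)" for x y
        proof -
          have "x \<in> set C" "y \<in> set C" using xy by (auto elim: vwalk_arcsE)
          moreover have "x \<rightarrow> y" "y \<rightarrow> x" using sub(2)[OF xy] adj_sym by auto
          ultimately show ?thesis using closed by blast
        qed
        show "set C \<inter> ?T \<noteq> {}" using S by blast
      qed
      then show False using S by blast
    qed
  qed
  have away: "away ?B I = I - set C"
    using inC degI unfolding away_def by blast
  obtain I' where I': "independent_set G I'" "ts_reachable G I I'"
    and acyc: "\<nexists>D. graph_cycle (G \<restriction> (I' \<union> ?B)) D"
    using res unfolding resolvable_def by blast
  let ?T = "away ?B I \<union> ?B"
  have "(ts_step G)\<^sup>*\<^sup>* I I'" using I'(2) by (simp add: ts_reachable_iff)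
  \<comment> \<open>The invariant: while the ring is intact, its tokens could be put on
    \<open>B\<close> and the moves away from \<open>B\<close> undone to reach \<open>?T\<close>.
    Once the ring breaks, \<open>I\<close> itself reaches \<open>?T\<close>, and this alternative
    persists.\<close>
  then have "ring_around ?B I' \<and> ts_reachable G (away ?B I' \<union> ?B) ?T \<or> ts_reachable G I ?T"
  proof (induct rule: rtranclp_induct)
    case base
    then show ?case using ring ts_reachable_refl[OF independent_away[OF B I]] by blast
  next
    case (step X X')
    have "ts_reachable G I X'"
      using step(1,2) I unfolding ts_reachable_iff by (meson rtranclp.rtrancl_into_rtrancl)
    then show ?case
      using step(3) ring_around_step[OF B _ step(2)] ts_reachable_trans ts_reachable_sym by blast
  qed
  \<comment> \<open>A ring around \<open>B\<close> at the end would have minimum degree two and thus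
    contain a cycle.\<close>
  moreover have "\<not> ring_around ?B I'"
  proof
    assume ring': "ring_around ?B I'"
    let ?S = "{a \<in> I'. \<exists>b\<in>?B. a \<rightarrow> b} \<union> ?B"
    have "finite ?S" using finite_independent_set[OF I'(1)] by simp
    moreover have "?S \<noteq> {}" using Bne by blast
    moreover have "\<exists>a\<in>?S. \<exists>b\<in>?S. a \<noteq> b \<and> w \<rightarrow> a \<and> w \<rightarrow> b" if w: "w \<in> ?S" for w
    proof (cases "w \<in> ?B")
      case True
      obtain p q where "p \<in> I'" "q \<in> I'" "p \<noteq> q" "w \<rightarrow> p" "w \<rightarrow> q"
        using ring_aroundD(2)[OF ring' True] by blast
      moreover from this have "p \<in> ?S" "q \<in> ?S" using True adj_sym by blast+
      ultimately show ?thesis by blast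
    next
      case False
      then obtain b where "w \<in> I'" "b \<in> ?B" "w \<rightarrow> b" using w by blast
      then show ?thesis using ring_aroundD(1)[OF ring'] by blast
    qed
    ultimately obtain D where "graph_cycle (G \<restriction> ?S) D" by (rule graph_cycle_if_min_degree_2)
    then have "graph_cycle (G \<restriction> (I' \<union> ?B)) D" by (rule graph_cycle_mono) blast
    then show False using acyc by blast
  qed
  ultimately show ?thesis using away by simp
qed

section \<open>Removing all cycles\<close>

text \<open>Induction on \<open>card (I - J)\<close>: switching one cycle removes its vertices from
  the symmetric difference and leaves the remaining cycles resolvable.\<close>

lemma resolvable_reachable:
  assumes "independent_set G I" "independent_set G J" "card I = card J"
    and "\<forall>C. graph_cycle (G \<restriction> sym_diff I J) C \<longrightarrow> resolvable G I C"
  shows "ts_reachable G I J"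
  using assms
proof (induct "card (I - J)" arbitrary: I rule: less_induct)
  case less
  note I = less.prems(1) and J = less.prems(2)
  show ?case
  proof (cases "\<exists>C. graph_cycle (G \<restriction> sym_diff I J) C")
    case False
    then show ?thesis using acyclic_reachable less.prems by blast
  next
    case True
    then obtain C where C: "graph_cycle (G \<restriction> sym_diff I J) C" by blast
    let ?I = "(I - set C) \<union> (set C - I)"
    note sub = graph_cycle_induce(1)[OF C]
    have r: "ts_reachable G I ?I" using resolve_cycle[OF I J C] less.prems(4) C by blast
    note I1 = ts_reachable_independent[OF r]
    have sd: "sym_diff ?I J = sym_diff I J - set C" using sub by blast
    \<comment> \<open>\<open>J\<close> is independent, so an edge of the cycle has an end in
      \<open>I - J\<close>; hence the measure drops.\<close>
    have "set C \<inter> (I - J) \<noteq> {}"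
    proof
      assume e: "set C \<inter> (I - J) = {}"
      obtain w where w: "w \<in> set C" using graph_cycle_induce(3)[OF C] by fastforce
      obtain p where "p \<in> set C" "w \<rightarrow> p" by (rule graph_cycle_degree[OF C w])
      then show False using e sub w independent_setD[OF J] by blast
    qed
    moreover have "?I - J = (I - J) - set C" using sub by blast
    ultimately have "card (?I - J) < card (I - J)"
      using finite_independent_set[OF I] by (intro psubset_card_mono) auto
    moreover have "card ?I = card J" using ts_reachable_card[OF r] less.prems(3) by simp
    \<comment> \<open>The set that resolves \<open>D\<close> for \<open>I\<close> still works: it is
      reachable from \<open>?I\<close> through \<open>I\<close>, and since \<open>D\<close> avoids
      \<open>C\<close> its part outside the token set is the same.\<close>
    moreover have "resolvable G ?I D" if D: "graph_cycle (G \<restriction> sym_diff ?I J) D" for D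
    proof -
      have "graph_cycle (G \<restriction> sym_diff I J) D" by (rule graph_cycle_mono[OF D]) (use sd in blast)
      then have "resolvable G I D" using less.prems(4) by blast
      moreover have "set D - ?I = set D - I"
        using graph_cycle_induce(1)[OF D] unfolding sd by blast
      moreover have "bad_cycle G ?I D" by (rule sym_diff_cycle_bad[OF I1 J D])
      ultimately show ?thesis
        using ts_reachable_trans[OF ts_reachable_sym[OF r]] unfolding resolvable_def by metis
    qed
    ultimately have "ts_reachable G ?I J" using less.hyps I1 J by blast
    then show ?thesis using r ts_reachable_trans by blast
  qed
qed

end

theorem theorem10:
  fixes G :: "('a,'b) pre_digraph" and I J :: "'a set"
  assumes "graph G" and "connected G" and "claw_free G"
    and "independent_set G I" and "independent_set G J" and "card I = card J"
  shows "ts_reachable G I J \<longleftrightarrow>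
    (\<forall>C. graph_cycle (G \<restriction> sym_diff I J) C \<longrightarrow> resolvable G I C)"
proof -
  interpret connected_claw_free_graph G
    using assms(1-3) by (simp add: connected_claw_free_graph_def claw_free_graph_def
        claw_free_graph_axioms_def connected_claw_free_graph_axioms_def)
  show ?thesis
  proof
    assume r: "ts_reachable G I J"
    show "\<forall>C. graph_cycle (G \<restriction> sym_diff I J) C \<longrightarrow> resolvable G I C"
    proof (intro allI impI)
      fix C assume C: "graph_cycle (G \<restriction> sym_diff I J) C"
      \<comment> \<open>The cycle lies in the symmetric difference, so its part outside
        \<open>I\<close> is in \<open>J\<close>. A cycle in the resulting graph would give an edge
        inside the independent set \<open>J\<close>.\<close>
      have sub: "J \<union> (set C - I) \<subseteq> J" using graph_cycle_induce(1)[OF C] by blast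
      have "\<not> graph_cycle (G \<restriction> (J \<union> (set C - I))) D" for D
      proof
        assume D: "graph_cycle (G \<restriction> (J \<union> (set C - I))) D"
        then obtain w where w: "w \<in> set D" using graph_cycle_induce(3) by fastforce
        obtain p where "p \<in> set D" "w \<rightarrow>\<^bsub>G\<^esub> p" by (rule graph_cycle_degree[OF D w])
        then show False using graph_cycle_induce(1)[OF D] sub w independent_setD[OF assms(5)] by blast
      qed
      then show "resolvable G I C" using sym_diff_cycle_bad[OF assms(4,5) C] r assms(5)
        unfolding resolvable_def by blast
    qed
  next
    assume "\<forall>C. graph_cycle (G \<restriction> sym_diff I J) C \<longrightarrow> resolvable G I C"
    then show "ts_reachable G I J" using resolvable_reachable assms(4-6) by blast
  qed
qed

end
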